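(* Let $f:(0,\infty)\to(0,\infty)$ be a Stieltjes function which is a bijection of $(0,\infty)$ onto $(0,\infty)$. Then the inverse function $f^{-1}:(0,\infty)\to(0,\infty)$ is also a Stieltjes function if and only if there is a constant $c>0$ such that $f(x)=c/x$ for all $x>0$.
   Context: A non-negative function $f$ on $(0,\infty)$ is called a Stieltjes function if there exist $a_0\ge 0$, $a_1\ge 0$ and a non-negative measure $\mu(dt)$ on $[0,\infty)$, with respect to which $t\mapsto (z+t)^{-1}$ is integrable for $z>0$, such that for all $z>0$ $$f(z)=a_0+\frac{a_1}{z}+\int_0^\infty\frac{1}{z+t}\,\mu(dt).$$ *)

theory Defs
  imports "HOL-Analysis.Analysis"
begin

text \<open>A function on the open half-line is represented by a total function \<^term>\<open>f :: real \<Rightarrow> real\<close> of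
  which only the values on \<^term>\<open>{0<..} :: real set\<close> matter. Since the measure \<^term>\<open>\<mu>\<close> has underlying
  space \<^term>\<open>{0..} :: real set\<close>, the unrestricted integral with respect to \<^term>\<open>\<mu>\<close> is the integral
  over the closed half-line. An atom of \<^term>\<open>\<mu>\<close> at \<^term>\<open>0 :: real\<close> is allowed.\<close>

definition stieltjes_function :: "(real \<Rightarrow> real) \<Rightarrow> bool" where
  "stieltjes_function f \<longleftrightarrow>
     (\<forall>z>0. 0 \<le> f z) \<and>
     (\<exists>a\<^sub>0 a\<^sub>1 (\<mu> :: real measure).
        0 \<le> a\<^sub>0 \<and> 0 \<le> a\<^sub>1 \<and>
        sets \<mu> = sets (restrict_space borel {0..}) \<and>
        (\<forall>z>0. integrable \<mu> (\<lambda>t. 1 / (z + t))) \<and>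
        (\<forall>z>0. f z = a\<^sub>0 + a\<^sub>1 / z + (\<integral>t. 1 / (z + t) \<partial>\<mu>)))"

end

theory Submission
  imports Defs
begin

text \<open>For each \<open>t \<ge> 0\<close> the kernel \<open>1 / (z + t)\<close> decreases in \<open>z\<close> while \<open>z / (z + t)\<close>
  increases. Integrating, a Stieltjes function \<open>f\<close> is nonincreasing (\<open>stieltjes_antimono\<close>), whereas
  \<open>z * f z\<close> is nondecreasing (\<open>stieltjes_times_arg_mono\<close>). If the inverse \<open>g\<close> is a Stieltjes
  function too, then \<open>y * g y\<close> is also nondecreasing in \<open>y\<close>; at \<open>y = f x\<close> this product is again
  \<open>x * f x\<close>, but \<open>f x\<close> moves down as \<open>x\<close> moves up, so \<open>x * f x\<close> is nonincreasing as well.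
  Therefore \<open>x * f x\<close> is constant. Conversely, \<open>c / x\<close> is its own inverse, and it is a Stieltjes
  function with zero measure.\<close>

lemma stieltjes_antimono:
  assumes "stieltjes_function f" "0 < x" "x \<le> y"
  shows "f y \<le> f x"
proof -
  from assms(1) obtain a b \<mu> where ab: "0 \<le> a" "0 \<le> b"
    and sets: "sets \<mu> = sets (restrict_space borel {0::real..})"
    and int: "\<And>z. z > 0 \<Longrightarrow> integrable \<mu> (\<lambda>t. 1 / (z + t))"
    and f: "\<And>z. z > 0 \<Longrightarrow> f z = a + b / z + (\<integral>t. 1 / (z + t) \<partial>\<mu>)"
    unfolding stieltjes_function_def by blast
  have space: "space \<mu> = {0..}"
    using sets_eq_imp_space_eq[OF sets] by simp
  have "(\<integral>t. 1 / (y + t) \<partial>\<mu>) \<le> (\<integral>t. 1 / (x + t) \<partial>\<mu>)"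
    using assms(2,3) int by (intro integral_mono) (auto simp: space intro!: divide_left_mono)
  moreover have "b / y \<le> b / x"
    using assms(2,3) ab by (intro divide_left_mono) auto
  ultimately show ?thesis
    using assms(2,3) f by simp
qed

lemma stieltjes_times_arg_mono:
  assumes "stieltjes_function f" "0 < x" "x \<le> y"
  shows "x * f x \<le> y * f y"
proof -
  from assms(1) obtain a b \<mu> where ab: "0 \<le> a" "0 \<le> b"
    and sets: "sets \<mu> = sets (restrict_space borel {0::real..})"
    and int: "\<And>z. z > 0 \<Longrightarrow> integrable \<mu> (\<lambda>t. 1 / (z + t))"
    and f: "\<And>z. z > 0 \<Longrightarrow> f z = a + b / z + (\<integral>t. 1 / (z + t) \<partial>\<mu>)"
    unfolding stieltjes_function_def by blast
  have space: "space \<mu> = {0..}"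
    using sets_eq_imp_space_eq[OF sets] by simp
  have expand: "z * f z = z * a + b + (\<integral>t. z * (1 / (z + t)) \<partial>\<mu>)" if "z > 0" for z
  proof -
    have "z * f z = z * (a + b / z + (\<integral>t. 1 / (z + t) \<partial>\<mu>))"
      by (simp only: f[OF that])
    also have "\<dots> = z * a + z * (b / z) + z * (\<integral>t. 1 / (z + t) \<partial>\<mu>)"
      by (simp only: distrib_left)
    also have "z * (b / z) = b"
      using that by simp
    finally show ?thesis
      by (simp only: integral_mult_right_zero)
  qed
  have kernel: "x * (1 / (x + t)) \<le> y * (1 / (y + t))" if "t \<ge> 0" for t
  proof -
    have "x * (y + t) \<le> y * (x + t)"
      using mult_right_mono[OF assms(3) that] by (simp add: algebra_simps)
    then show ?thesis
      using that assms(2,3) by (simp add: divide_le_eq pos_le_divide_eq)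
  qed
  have "(\<integral>t. x * (1 / (x + t)) \<partial>\<mu>) \<le> (\<integral>t. y * (1 / (y + t)) \<partial>\<mu>)"
  proof (rule integral_mono)
    show "integrable \<mu> (\<lambda>t. x * (1 / (x + t)))" "integrable \<mu> (\<lambda>t. y * (1 / (y + t)))"
      using assms(2,3) by (intro integrable_mult_right int; linarith)+
  qed (use kernel in \<open>simp only: space atLeast_iff\<close>)
  moreover have "x * a \<le> y * a"
    using assms(3) ab(1) by (rule mult_right_mono)
  ultimately show ?thesis
    using expand[of x] expand[of y] assms(2,3) by linarith
qed

lemma stieltjes_reciprocal:
  assumes "0 \<le> c" "\<And>x. x > 0 \<Longrightarrow> f x = c / x"
  shows "stieltjes_function f"
proof -
  let ?\<mu> = "null_measure (restrict_space borel {0::real..})"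
  have "\<forall>z>0. 0 \<le> f z"
    using assms by simp
  moreover have "sets ?\<mu> = sets (restrict_space borel {0..})"
    by simp
  moreover have "integrable ?\<mu> (\<lambda>t. 1 / (z + t))" for z
    unfolding integrable_null_measure_iff by (intro measurable_restrict_space1) simp
  moreover have "\<forall>z>0. f z = 0 + c / z + (\<integral>t. 1 / (z + t) \<partial>?\<mu>)"
    using assms(2) by simp
  ultimately show ?thesis
    unfolding stieltjes_function_def using assms(1) order_refl by blast
qed

theorem corollary1:
  fixes f :: "real \<Rightarrow> real"
  assumes "stieltjes_function f"
    and "bij_betw f {0<..} {0<..}"
  shows "stieltjes_function (the_inv_into {0<..} f) \<longleftrightarrow> (\<exists>c>0. \<forall>x>0. f x = c / x)"
proof
  let ?g = "the_inv_into {0<..} f"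
  assume g: "stieltjes_function ?g"
  have pos: "f x > 0" if "x > 0" for x
    using bij_betwE[OF assms(2)] that by auto
  have inv: "?g (f x) = x" if "x > 0" for x
    using assms(2) that by (simp add: bij_betw_def the_inv_into_f_f)
  have const: "x * f x = y * f y" if "0 < x" "x \<le> y" for x y
  proof (rule antisym)
    show "x * f x \<le> y * f y"
      using assms(1) that by (rule stieltjes_times_arg_mono)
    have "f y * ?g (f y) \<le> f x * ?g (f x)"
      using that pos
      by (intro stieltjes_times_arg_mono[OF g] stieltjes_antimono[OF assms(1)]) auto
    then show "y * f y \<le> x * f x"
      using that inv by (simp add: mult.commute)
  qed
  have reciprocal: "f x = f 1 / x" if "x > 0" for x
  proof -
    have "x * f x = f 1"
      using const[of x 1] const[of 1 x] that by linarith
    then show ?thesis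
      using that by (simp add: eq_divide_eq mult.commute)
  qed
  show "\<exists>c>0. \<forall>x>0. f x = c / x"
    by (intro exI[of _ "f 1"] conjI allI impI) (rule pos[OF zero_less_one], erule reciprocal)
next
  assume "\<exists>c>0. \<forall>x>0. f x = c / x"
  then obtain c where c: "c > 0" "\<And>x. x > 0 \<Longrightarrow> f x = c / x"
    by blast
  have "the_inv_into {0<..} f y = c / y" if "y > 0" for y
  proof (rule the_inv_into_f_eq)
    show "inj_on f {0<..}"
      using assms(2) by (rule bij_betw_imp_inj_on)
    show "c / y \<in> {0<..}"
      using c(1) that by simp
    then show "f (c / y) = y"
      using c by simp
  qed
  then show "stieltjes_function (the_inv_into {0<..} f)"
    using c(1) by (intro stieltjes_reciprocal[of c]) simp_all
qed

end
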